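(* There exists a countably generated spatial frame $L_0$ such that $|L_0|=2^{\aleph_0}$, the Scott space $\Sigma L_0$ is non-sober, and $$\sigma(L_0)\times\sigma(L_0)\subsetneq\sigma(L_0\times L_0),$$ where the left-hand side is the product topology and the right-hand side the Scott topology of the coordinatewise order. Consequently, the statement "for every family $(L_i)_{i\in I}$ of countably presented frames, $\Sigma(\prod_{i\in I}L_i)=\prod_{i\in I}\Sigma L_i$" becomes false if "countably presented" is replaced by "countably generated", even for spatial frames and a two-fold self-product.
   Context: A frame is a complete lattice $L$ with $a\wedge\bigvee S=\bigvee_{s\in S}(a\wedge s)$ for all $a\in L$, $S\subseteq L$. It is spatial if it is isomorphic to the lattice $\mathcal O(X)$ of open sets of some topological space $X$. It is countably generated if some countable subset generates it under finite meets and arbitrary joins; it is countably presented if it admits a presentation in the category of frames with countably many generators and countably many relations. For a poset $P$, a subset $U$ is Scott open if it is an upper set and every directed set $D$ having a supremum $\bigvee D\in U$ meets $U$; $\sigma(P)$ is the Scott topology and $\Sigma P=(P,\sigma(P))$. A $T_0$ space is sober if every (nonempty) irreducible closed subset is the closure of a unique point. *)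

theory Defs
  imports
    "HOL-Analysis.Analysis"
    "HOL-Algebra.Complete_Lattice"
    "HOL-Library.Equipollence"
begin

section \<open>Frames\<close>

locale frame = complete_lattice L for L (structure) +
  assumes meet_Sup_distrib:
    "\<lbrakk>a \<in> carrier L; S \<subseteq> carrier L\<rbrakk> \<Longrightarrow> a \<sqinter> \<Squnion>S = \<Squnion>{a \<sqinter> s |s. s \<in> S}"

definition order_isomorphic :: "('a, 'c) gorder_scheme \<Rightarrow> ('b, 'd) gorder_scheme \<Rightarrow> bool" where
  "order_isomorphic L M \<longleftrightarrow> (\<exists>f. bij_betw f (carrier L) (carrier M) \<and> order_emb L M f)"

definition opens :: "'a topology \<Rightarrow> 'a set gorder" where
  "opens X = \<lparr>carrier = {U. openin X U}, eq = (=), le = (\<subseteq>)\<rparr>"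

text \<open>
  Points of the representing space may be taken in \<^typ>\<open>'a set\<close> without loss of generality:
  the open set lattice of a space is unchanged by passing to its \<open>T\<^sub>0\<close> quotient, and a point of
  a \<open>T\<^sub>0\<close> space is determined by the set of elements of \<open>L\<close> corresponding to its open
  neighbourhoods.
\<close>
definition spatial :: "('a, 'b) gorder_scheme \<Rightarrow> bool" where
  "spatial L \<longleftrightarrow> (\<exists>X :: 'a set topology. order_isomorphic L (opens X))"

text \<open>The empty meet and the empty join are included, so a subframe contains top and bottom.\<close>
definition subframe :: "'a set \<Rightarrow> ('a, 'b) gorder_scheme \<Rightarrow> bool" where
  "subframe S L \<longleftrightarrow> S \<subseteq> carrier L \<and>
     (\<forall>F. finite F \<and> F \<subseteq> S \<longrightarrow> \<Sqinter>\<^bsub>L\<^esub>F \<in> S) \<and> (\<forall>A. A \<subseteq> S \<longrightarrow> \<Squnion>\<^bsub>L\<^esub>A \<in> S)"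

definition countably_generated :: "('a, 'b) gorder_scheme \<Rightarrow> bool" where
  "countably_generated L \<longleftrightarrow>
     (\<exists>G \<subseteq> carrier L. countable G \<and> (\<forall>S. subframe S L \<and> G \<subseteq> S \<longrightarrow> S = carrier L))"

section \<open>The Scott topology\<close>

definition directed_in :: "('a, 'b) gorder_scheme \<Rightarrow> 'a set \<Rightarrow> bool" where
  "directed_in P D \<longleftrightarrow> D \<subseteq> carrier P \<and> D \<noteq> {} \<and>
     (\<forall>x\<in>D. \<forall>y\<in>D. \<exists>z\<in>D. x \<sqsubseteq>\<^bsub>P\<^esub> z \<and> y \<sqsubseteq>\<^bsub>P\<^esub> z)"

definition scott_open :: "('a, 'b) gorder_scheme \<Rightarrow> 'a set \<Rightarrow> bool" where
  "scott_open P U \<longleftrightarrow> U \<subseteq> carrier P \<and>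
     (\<forall>x\<in>U. \<forall>y\<in>carrier P. x \<sqsubseteq>\<^bsub>P\<^esub> y \<longrightarrow> y \<in> U) \<and>
     (\<forall>D s. directed_in P D \<and> least P s (Upper P D) \<and> s \<in> U \<longrightarrow> D \<inter> U \<noteq> {})"

definition scott :: "('a, 'b) gorder_scheme \<Rightarrow> 'a topology" where
  "scott P = topology (scott_open P)"

lemma istopology_scott_open: "istopology (scott_open P)"
  unfolding istopology_def
proof (intro conjI allI impI)
  fix U V assume U: "scott_open P U" and V: "scott_open P V"
  have "D \<inter> (U \<inter> V) \<noteq> {}"
    if D: "directed_in P D" and s: "least P s (Upper P D)" "s \<in> U \<inter> V" for D s
  proof -
    obtain x y where xy: "x \<in> D" "x \<in> U" "y \<in> D" "y \<in> V"
      using U V D s unfolding scott_open_def by blast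
    then obtain z where z: "z \<in> D" "x \<sqsubseteq>\<^bsub>P\<^esub> z" "y \<sqsubseteq>\<^bsub>P\<^esub> z"
      using D unfolding directed_in_def by blast
    have "z \<in> carrier P"
      using z(1) D unfolding directed_in_def by blast
    then have "z \<in> U \<inter> V"
      using U V xy z unfolding scott_open_def by blast
    then show ?thesis
      using z(1) by blast
  qed
  then show "scott_open P (U \<inter> V)"
    using U V unfolding scott_open_def by blast
next
  fix \<K> assume \<K>: "\<forall>K\<in>\<K>. scott_open P K"
  show "scott_open P (\<Union>\<K>)"
    unfolding scott_open_def
  proof (intro conjI ballI allI impI)
    show "\<Union>\<K> \<subseteq> carrier P"
      using \<K> by (auto simp: scott_open_def)
  next
    fix x y assume "x \<in> \<Union>\<K>" "y \<in> carrier P" "x \<sqsubseteq>\<^bsub>P\<^esub> y"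
    then obtain K where "K \<in> \<K>" "x \<in> K" by blast
    then show "y \<in> \<Union>\<K>"
      using \<K> \<open>y \<in> carrier P\<close> \<open>x \<sqsubseteq>\<^bsub>P\<^esub> y\<close> unfolding scott_open_def by (meson UnionI)
  next
    fix D s assume *: "directed_in P D \<and> least P s (Upper P D) \<and> s \<in> \<Union>\<K>"
    then obtain K where K: "K \<in> \<K>" "s \<in> K" by blast
    with \<K> * have "D \<inter> K \<noteq> {}"
      unfolding scott_open_def by meson
    then show "D \<inter> \<Union>\<K> \<noteq> {}"
      using K by blast
  qed
qed

lemma openin_scott: "openin (scott P) U \<longleftrightarrow> scott_open P U"
  by (simp add: scott_def istopology_scott_open)

lemma topspace_scott: "topspace (scott P) = carrier P"
proof -
  have "scott_open P (carrier P)"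
    by (auto simp: scott_open_def directed_in_def)
  moreover have "U \<subseteq> carrier P" if "scott_open P U" for U
    using that by (simp add: scott_open_def)
  ultimately show ?thesis
    unfolding topspace_def openin_scott by blast
qed

section \<open>Sobriety\<close>

definition irreducible_closedin :: "'a topology \<Rightarrow> 'a set \<Rightarrow> bool" where
  "irreducible_closedin X C \<longleftrightarrow> closedin X C \<and> C \<noteq> {} \<and>
     (\<forall>A B. closedin X A \<and> closedin X B \<and> C \<subseteq> A \<union> B \<longrightarrow> C \<subseteq> A \<or> C \<subseteq> B)"

definition sober :: "'a topology \<Rightarrow> bool" where
  "sober X \<longleftrightarrow> t0_space X \<and>
     (\<forall>C. irreducible_closedin X C \<longrightarrow> (\<exists>!x. x \<in> topspace X \<and> C = X closure_of {x}))"

text \<open>Scott spaces of posets are \<open>T\<^sub>0\<close>, so their non-sobriety is never a failure of \<open>T\<^sub>0\<close>.\<close>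
lemma (in partial_order) t0_space_scott: "t0_space (scott L)"
proof -
  have op: "openin (scott L) {z \<in> carrier L. \<not> z \<sqsubseteq> y}" if y: "y \<in> carrier L" for y
    unfolding openin_scott scott_open_def
  proof (intro conjI ballI allI impI)
    fix x z assume "x \<in> {z \<in> carrier L. \<not> z \<sqsubseteq> y}" "z \<in> carrier L" "x \<sqsubseteq> z"
    then show "z \<in> {z \<in> carrier L. \<not> z \<sqsubseteq> y}"
      using y le_trans by blast
  next
    fix D s assume *: "directed_in L D \<and> least L s (Upper L D) \<and> s \<in> {z \<in> carrier L. \<not> z \<sqsubseteq> y}"
    then have D: "D \<subseteq> carrier L"
      by (simp add: directed_in_def)
    have "y \<notin> Upper L D"
      using * y by (auto dest: least_le)
    then show "D \<inter> {z \<in> carrier L. \<not> z \<sqsubseteq> y} \<noteq> {}"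
      using D y unfolding Upper_def by blast
  qed blast
  show ?thesis
    unfolding t0_space_def topspace_scott
  proof (intro ballI impI)
    fix x y assume x: "x \<in> carrier L" and y: "y \<in> carrier L" and "x \<noteq> y"
    then consider "\<not> x \<sqsubseteq> y" | "\<not> y \<sqsubseteq> x"
      using le_antisym by blast
    then show "\<exists>U. openin (scott L) U \<and> (x \<notin> U) = (y \<in> U)"
    proof cases
      case 1 then show ?thesis
        using op[OF y] x y by (intro exI[of _ "{z \<in> carrier L. \<not> z \<sqsubseteq> y}"]) auto
    next
      case 2 then show ?thesis
        using op[OF x] x y by (intro exI[of _ "{z \<in> carrier L. \<not> z \<sqsubseteq> x}"]) auto
    qed
  qed
qed

section \<open>Products of posets\<close>

definition prod_order :: "('a, 'c) gorder_scheme \<Rightarrow> ('b, 'd) gorder_scheme \<Rightarrow> ('a \<times> 'b) gorder" where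
  "prod_order L M = \<lparr>carrier = carrier L \<times> carrier M, eq = (=),
     le = (\<lambda>p q. fst p \<sqsubseteq>\<^bsub>L\<^esub> fst q \<and> snd p \<sqsubseteq>\<^bsub>M\<^esub> snd q)\<rparr>"

definition product_order :: "('i \<Rightarrow> ('a, 'b) gorder_scheme) \<Rightarrow> 'i set \<Rightarrow> ('i \<Rightarrow> 'a) gorder" where
  "product_order L I = \<lparr>carrier = (\<Pi>\<^sub>E i\<in>I. carrier (L i)), eq = (=),
     le = (\<lambda>x y. \<forall>i\<in>I. x i \<sqsubseteq>\<^bsub>L i\<^esub> y i)\<rparr>"

end

theory Submission
  imports Defs "HOL-Library.Sublist"
begin

text \<open>
  The frame \<open>L\<^sub>0\<close> consists of the open sets of a compact \<open>T\<^sub>1\<close> topology on \<open>\<nat>\<close> with a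
  countable subbase. For every ordered pair of points \<open>(a, b)\<close> there is a separate block of points
  indexed by finite sequences, in which the subtrees along any infinite branch shrink to \<open>a\<close>, and in
  which \<open>b\<close> is approached by the fans: a fan is the intersection of its one-step extensions, and
  the empty fan is \<open>{b}\<close>. Let \<open>\<U>\<close> and \<open>\<V>\<close> be Scott open with
  \<open>- {a} \<in> \<U>\<close> and \<open>- {b} \<in> \<V>\<close>. Extending the fan step by step within \<open>\<V>\<close> produces
  an infinite branch, and \<open>\<U>\<close> contains the complement of a subtree along that very branch; the root
  of this subtree also lies in the fan, so its complement belongs to both \<open>\<U>\<close> and \<open>\<V>\<close>.

  Hence the proper open sets form an irreducible Scott closed set (closed by compactness), and it
  has no greatest element, so it is not the closure of a point. In the same way
  \<open>{(U, V). U \<union> V = \<nat>}\<close> is Scott open by compactness but contains no Scott open rectangle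
  around \<open>(- {a}, - {b})\<close> when \<open>a \<noteq> b\<close>.
\<close>

section \<open>Frames of open sets\<close>

lemma carrier_opens [simp]: "carrier (opens X) = {U. openin X U}"
  and le_opens [simp]: "le (opens X) = (\<subseteq>)"
  and eq_opens [simp]: "eq (opens X) = (=)"
  by (simp_all add: opens_def)

lemma partial_order_opens: "partial_order (opens X)"
  by standard auto

lemma least_opens:
  assumes "A \<subseteq> carrier (opens X)"
  shows "least (opens X) (\<Union>A) (Upper (opens X) A)"
  using assms by (auto simp: least_def Upper_def subset_iff)

text \<open>Infinite intersections need an interior; the factor \<open>topspace X\<close> covers
  \<open>A = {}\<close>, where \<open>\<Inter>A\<close> is the whole type.\<close>

lemma greatest_opens:
  assumes "A \<subseteq> carrier (opens X)"
  shows "greatest (opens X) (X interior_of (topspace X \<inter> \<Inter>A)) (Lower (opens X) A)"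
proof -
  have "X interior_of (topspace X \<inter> \<Inter>A) \<subseteq> U" if "U \<in> A" for U
    using interior_of_subset[of X "topspace X \<inter> \<Inter>A"] that by blast
  moreover have "W \<subseteq> X interior_of (topspace X \<inter> \<Inter>A)" if "W \<in> Lower (opens X) A" for W
  proof (rule interior_of_maximal)
    show "W \<subseteq> topspace X \<inter> \<Inter>A"
      using that assms openin_subset by (fastforce simp: Lower_def)
  qed (use that in \<open>simp add: Lower_def\<close>)
  ultimately show ?thesis
    by (auto simp: greatest_def Lower_def)
qed

lemma complete_lattice_opens: "complete_lattice (opens X)"
  by (rule partial_order.complete_latticeI[OF partial_order_opens])
    (blast intro: least_opens greatest_opens)+

lemma sup_opens:
  assumes "A \<subseteq> carrier (opens X)"
  shows "\<Squnion>\<^bsub>opens X\<^esub>A = \<Union>A"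
  unfolding sup_def
proof (rule some_equality)
  show "least (opens X) (\<Union>A) (Upper (opens X) A)"
    by (rule least_opens[OF assms])
  then show "U = \<Union>A" if "least (opens X) U (Upper (opens X) A)" for U
    using that by (rule partial_order.least_unique[OF partial_order_opens, rotated])
qed

lemma inf_opens:
  assumes "A \<subseteq> carrier (opens X)" "finite A"
  shows "\<Sqinter>\<^bsub>opens X\<^esub>A = topspace X \<inter> \<Inter>A"
proof -
  have "openin X (topspace X \<inter> \<Inter>A)"
  proof (cases "A = {}")
    case False
    then have "openin X (\<Inter>A)"
      using assms by (intro openin_Inter) auto
    then show ?thesis
      by blast
  qed simp
  then have gr: "greatest (opens X) (topspace X \<inter> \<Inter>A) (Lower (opens X) A)"
    using greatest_opens[OF assms(1)] by (simp add: interior_of_openin)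
  show ?thesis
    unfolding inf_def
  proof (rule some_equality)
    show "greatest (opens X) (topspace X \<inter> \<Inter>A) (Lower (opens X) A)"
      by (rule gr)
    show "U = topspace X \<inter> \<Inter>A" if "greatest (opens X) U (Lower (opens X) A)" for U
      using that gr by (rule partial_order.greatest_unique[OF partial_order_opens])
  qed
qed

lemma meet_opens:
  assumes "openin X U" "openin X V"
  shows "U \<sqinter>\<^bsub>opens X\<^esub> V = U \<inter> V"
  unfolding meet_def using assms openin_subset by (subst inf_opens) auto

lemma frame_opens: "frame (opens X)"
proof -
  interpret complete_lattice "opens X"
    by (rule complete_lattice_opens)
  show ?thesis
  proof
    fix U S assume U: "U \<in> carrier (opens X)" and S: "S \<subseteq> carrier (opens X)"
    have "{U \<sqinter>\<^bsub>opens X\<^esub> V |V. V \<in> S} = {U \<inter> V |V. V \<in> S}"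
      using U S meet_opens by (metis (no_types, lifting) carrier_opens mem_Collect_eq subsetD)
    moreover have "{U \<inter> V |V. V \<in> S} \<subseteq> carrier (opens X)"
      using U S by auto
    ultimately have "\<Squnion>\<^bsub>opens X\<^esub>{U \<sqinter>\<^bsub>opens X\<^esub> V |V. V \<in> S} = \<Union>{U \<inter> V |V. V \<in> S}"
      by (simp only: sup_opens)
    moreover have "openin X (\<Union>S)"
      using S by auto
    then have "U \<sqinter>\<^bsub>opens X\<^esub> \<Squnion>\<^bsub>opens X\<^esub>S = U \<inter> \<Union>S"
      using U S by (simp add: sup_opens meet_opens)
    ultimately show "U \<sqinter>\<^bsub>opens X\<^esub> \<Squnion>\<^bsub>opens X\<^esub>S = \<Squnion>\<^bsub>opens X\<^esub>{U \<sqinter>\<^bsub>opens X\<^esub> V |V. V \<in> S}"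
      by auto
  qed
qed

text \<open>\<open>spatial\<close> asks for a space on sets of lattice elements, here sets of sets
  of points, so the topology is transported along an injection of the points into that type.\<close>

lemma spatial_opens: "spatial (opens X)"
proof -
  define i :: "'a \<Rightarrow> 'a set set" where "i x = {{x}}" for x
  have inj: "inj_on i A" for A
    by (auto simp: i_def inj_on_def)
  have img: "i ` U \<inter> i ` V = i ` (U \<inter> V)" for U V
    by (auto simp: i_def)
  have ist: "istopology (\<lambda>W. \<exists>U. openin X U \<and> W = i ` U)"
    unfolding istopology_def
  proof (intro conjI allI impI)
    fix \<K> assume "\<forall>K\<in>\<K>. \<exists>U. openin X U \<and> K = i ` U"
    then obtain g where g: "\<And>K. K \<in> \<K> \<Longrightarrow> openin X (g K) \<and> K = i ` g K"
      by metis
    then have "openin X (\<Union>(g ` \<K>))"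
      by blast
    moreover have "\<Union>\<K> = i ` \<Union>(g ` \<K>)"
      using g by (simp add: image_Union image_image cong: image_cong_simp)
    ultimately show "\<exists>U. openin X U \<and> \<Union>\<K> = i ` U"
      by blast
  next
    fix V W assume "\<exists>U. openin X U \<and> V = i ` U" "\<exists>U. openin X U \<and> W = i ` U"
    then show "\<exists>U. openin X U \<and> V \<inter> W = i ` U"
      using img openin_Int by metis
  qed
  define Y where "Y = topology (\<lambda>W. \<exists>U. openin X U \<and> W = i ` U)"
  have Y: "openin Y W \<longleftrightarrow> (\<exists>U. openin X U \<and> W = i ` U)" for W
    by (simp add: Y_def ist)
  have "bij_betw (image i) (carrier (opens X)) (carrier (opens Y))"
    using inj by (auto simp: bij_betw_def Y intro: inj_on_image)
  moreover have "order_emb (opens X) (opens Y) (image i)"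
    unfolding order_emb_def
    using partial_order_opens[of X, THEN partial_order.axioms(1)]
      partial_order_opens[of Y, THEN partial_order.axioms(1)] inj
    by (auto simp: inj_image_subset_iff)
  ultimately show ?thesis
    unfolding spatial_def order_isomorphic_def by blast
qed

text \<open>A subframe containing the sets \<open>T \<inter> U\<close> is closed under finite meets,
  including the empty one \<open>T\<close>, and under unions, hence contains every open set.\<close>

lemma countably_generated_opens:
  assumes "countable B"
    and X: "topology (arbitrary union_of (finite intersection_of (\<lambda>U. U \<in> B) relative_to T)) = X"
  shows "countably_generated (opens X)"
proof -
  have top: "topspace X = T"
    unfolding X[symmetric] by (rule topspace_subbase)
  have op: "openin X W \<longleftrightarrow>
      (arbitrary union_of (finite intersection_of (\<lambda>U. U \<in> B) relative_to T)) W" for W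
    unfolding X[symmetric] by (rule openin_subbase)
  have B: "openin X (T \<inter> U)" if "U \<in> B" for U
    unfolding op using that
    by (intro arbitrary_union_of_inc relative_to_inc finite_intersection_of_inc)
  have "W \<in> S" if S: "subframe S (opens X)" "(\<inter>) T ` B \<subseteq> S" and "openin X W" for S W
  proof -
    have "V \<in> S" if "(finite intersection_of (\<lambda>U. U \<in> B) relative_to T) V" for V
    proof -
      obtain F where F: "finite F" "F \<subseteq> B" "V = T \<inter> \<Inter>F"
        using \<open>(finite intersection_of (\<lambda>U. U \<in> B) relative_to T) V\<close>
        by (auto simp: relative_to_def intersection_of_def)
      have sub: "(\<inter>) T ` F \<subseteq> carrier (opens X)"
        using F B by auto
      have "\<Sqinter>\<^bsub>opens X\<^esub>((\<inter>) T ` F) \<in> S"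
        using S F unfolding subframe_def by (metis finite_imageI image_mono order_trans)
      then show ?thesis
        using F sub by (simp add: inf_opens top split: if_splits)
    qed
    moreover obtain \<U> where "\<U> \<subseteq> Collect (finite intersection_of (\<lambda>U. U \<in> B) relative_to T)" "W = \<Union>\<U>"
      using \<open>openin X W\<close> unfolding op by (auto simp: union_of_def)
    ultimately have \<U>: "\<U> \<subseteq> S" "W = \<Union>\<U>"
      by auto
    then have "\<Squnion>\<^bsub>opens X\<^esub>\<U> \<in> S"
      using S unfolding subframe_def by blast
    moreover have "\<U> \<subseteq> carrier (opens X)"
      using \<U> S unfolding subframe_def by blast
    ultimately show ?thesis
      using \<U> by (simp add: sup_opens)
  qed
  then have "carrier (opens X) \<subseteq> S" if "subframe S (opens X)" "(\<inter>) T ` B \<subseteq> S" for S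
    using that by auto
  then have "S = carrier (opens X)" if "subframe S (opens X)" "(\<inter>) T ` B \<subseteq> S" for S
    using that by (simp add: subframe_def subset_antisym)
  moreover have "(\<inter>) T ` B \<subseteq> carrier (opens X)"
    using B by auto
  ultimately show ?thesis
    unfolding countably_generated_def using assms(1)
    by (intro exI[of _ "(\<inter>) T ` B"]) blast
qed

section \<open>Scott topologies and products\<close>

lemma Upper_prod_order:
  assumes "D \<subseteq> carrier P \<times> carrier Q"
  shows "c \<in> Upper (prod_order P Q) D \<longleftrightarrow> c \<in> carrier P \<times> carrier Q \<and>
    (\<forall>d\<in>D. fst d \<sqsubseteq>\<^bsub>P\<^esub> fst c \<and> snd d \<sqsubseteq>\<^bsub>Q\<^esub> snd c)"
  using assms by (auto simp: Upper_def prod_order_def)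

text \<open>Suprema in the product are coordinatewise, so both projections of a directed set are
  directed with the projected suprema; directedness then merges the two points found in
  \<open>U\<close> and \<open>V\<close>.\<close>

lemma scott_open_Times:
  assumes U: "scott_open P U" and V: "scott_open Q V"
  shows "scott_open (prod_order P Q) (U \<times> V)"
  unfolding scott_open_def
proof (intro conjI ballI allI impI)
  show "U \<times> V \<subseteq> carrier (prod_order P Q)"
    using U V by (auto simp: scott_open_def prod_order_def)
next
  fix x y assume "x \<in> U \<times> V" "y \<in> carrier (prod_order P Q)" "x \<sqsubseteq>\<^bsub>prod_order P Q\<^esub> y"
  then show "y \<in> U \<times> V"
    using U V unfolding scott_open_def prod_order_def by fastforce
next
  fix D s
  assume *: "directed_in (prod_order P Q) D \<and> least (prod_order P Q) s (Upper (prod_order P Q) D) \<and> s \<in> U \<times> V"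
  then have D: "D \<subseteq> carrier P \<times> carrier Q" "D \<noteq> {}"
    and dir: "\<And>x y. x \<in> D \<Longrightarrow> y \<in> D \<Longrightarrow> \<exists>z\<in>D. fst x \<sqsubseteq>\<^bsub>P\<^esub> fst z \<and> snd x \<sqsubseteq>\<^bsub>Q\<^esub> snd z \<and>
          fst y \<sqsubseteq>\<^bsub>P\<^esub> fst z \<and> snd y \<sqsubseteq>\<^bsub>Q\<^esub> snd z"
    by (auto simp: directed_in_def prod_order_def)
  have "s \<in> Upper (prod_order P Q) D"
    and least: "\<And>c. c \<in> Upper (prod_order P Q) D \<Longrightarrow> s \<sqsubseteq>\<^bsub>prod_order P Q\<^esub> c"
    using * by (simp_all add: least_def)
  then have s: "fst s \<in> carrier P" "snd s \<in> carrier Q"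
    and up: "\<And>d. d \<in> D \<Longrightarrow> fst d \<sqsubseteq>\<^bsub>P\<^esub> fst s \<and> snd d \<sqsubseteq>\<^bsub>Q\<^esub> snd s"
    by (simp_all add: Upper_prod_order[OF D(1)] mem_Times_iff)
  have low: "fst s \<sqsubseteq>\<^bsub>P\<^esub> fst c \<and> snd s \<sqsubseteq>\<^bsub>Q\<^esub> snd c"
    if "c \<in> carrier P \<times> carrier Q" "\<forall>d\<in>D. fst d \<sqsubseteq>\<^bsub>P\<^esub> fst c \<and> snd d \<sqsubseteq>\<^bsub>Q\<^esub> snd c" for c
    using that least[of c] by (simp add: Upper_prod_order[OF D(1)]) (simp add: prod_order_def)
  have sub: "fst ` D \<subseteq> carrier P" "snd ` D \<subseteq> carrier Q"
    using D by auto
  have dirs: "directed_in P (fst ` D)" "directed_in Q (snd ` D)"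
    using D(2) sub dir unfolding directed_in_def ball_simps bex_simps by blast+
  \<comment> \<open>Freezing the second coordinate at \<open>snd s\<close> turns an upper bound of
    the first projection into one of \<open>D\<close>.\<close>
  have "fst s \<sqsubseteq>\<^bsub>P\<^esub> c" if "c \<in> Upper P (fst ` D)" for c
    using that low[of "(c, snd s)"] s up sub by (simp add: Upper_def image_subset_iff)
  then have "least P (fst s) (Upper P (fst ` D))"
    using s up by (auto simp: least_def Upper_def)
  moreover have "snd s \<sqsubseteq>\<^bsub>Q\<^esub> c" if "c \<in> Upper Q (snd ` D)" for c
    using that low[of "(fst s, c)"] s up sub by (simp add: Upper_def image_subset_iff)
  then have "least Q (snd s) (Upper Q (snd ` D))"
    using s up by (auto simp: least_def Upper_def)
  moreover have "fst s \<in> U" "snd s \<in> V"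
    using * by auto
  ultimately have "fst ` D \<inter> U \<noteq> {}" "snd ` D \<inter> V \<noteq> {}"
    using U V dirs unfolding scott_open_def by blast+
  then obtain x y where xy: "x \<in> D" "fst x \<in> U" "y \<in> D" "snd y \<in> V"
    by blast
  then obtain z where z: "z \<in> D" "fst x \<sqsubseteq>\<^bsub>P\<^esub> fst z" "snd y \<sqsubseteq>\<^bsub>Q\<^esub> snd z"
    using dir by blast
  moreover have "fst z \<in> carrier P" "snd z \<in> carrier Q"
    using z D by auto
  ultimately have "fst z \<in> U" "snd z \<in> V"
    using U V xy unfolding scott_open_def by blast+
  then show "D \<inter> (U \<times> V) \<noteq> {}"
    using z by (metis disjoint_iff mem_Times_iff)
qed

lemma openin_prod_topology_imp_scott:
  assumes "openin (prod_topology (scott P) (scott Q)) W"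
  shows "openin (scott (prod_order P Q)) W"
proof (subst openin_subopen, intro ballI)
  fix w assume "w \<in> W"
  then obtain U V where "scott_open P U" "scott_open Q V" "w \<in> U \<times> V" "U \<times> V \<subseteq> W"
    using assms unfolding openin_prod_topology_alt openin_scott by (metis mem_Sigma_iff surj_pair)
  then show "\<exists>T. openin (scott (prod_order P Q)) T \<and> w \<in> T \<and> T \<subseteq> W"
    using scott_open_Times openin_scott by metis
qed

section \<open>Scott open families of open sets\<close>

lemma scott_open_UN_incseq:
  fixes F :: "nat \<Rightarrow> 'a set"
  assumes "scott_open (opens X) \<U>" and F: "\<And>n. openin X (F n)" "incseq F"
    and "(\<Union>n. F n) \<in> \<U>"
  shows "\<exists>n. F n \<in> \<U>"
proof -
  have "\<exists>k. F m \<subseteq> F k \<and> F n \<subseteq> F k" for m n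
    using F(2) by (metis incseqD max.cobounded1 max.cobounded2)
  then have "directed_in (opens X) (range F)"
    using F(1) by (auto simp: directed_in_def)
  moreover have "least (opens X) (\<Union>n. F n) (Upper (opens X) (range F))"
    using F(1) by (intro least_opens) auto
  ultimately have "range F \<inter> \<U> \<noteq> {}"
    using assms(1,4) unfolding scott_open_def by blast
  then show ?thesis
    by blast
qed

text \<open>Since the complement of the principal ideal of \<open>W\<close> is Scott open, the
  closure of \<open>{W}\<close> contains only subsets of \<open>W\<close>.\<close>

lemma scott_open_not_subset:
  assumes "openin X W"
  shows "scott_open (opens X) {U. openin X U \<and> \<not> U \<subseteq> W}"
proof -
  have "D \<inter> {U. openin X U \<and> \<not> U \<subseteq> W} \<noteq> {}"
    if D: "directed_in (opens X) D" and s: "least (opens X) s (Upper (opens X) D)" "\<not> s \<subseteq> W" for D s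
  proof -
    have "W \<notin> Upper (opens X) D"
      using s by (auto simp: least_def)
    then show ?thesis
      using D assms by (auto simp: Upper_def directed_in_def)
  qed
  then show ?thesis
    by (auto simp: scott_open_def)
qed

text \<open>A directed supremum that covers has a finite subcover, whose indices are bounded by one
  member. The maps \<open>p\<close> and \<open>q\<close> let one argument serve
  \<open>opens X\<close>, its binary product and its indexed product.\<close>

lemma scott_open_compact_cover:
  assumes "compact_space X"
    and op: "\<And>w. w \<in> carrier P \<Longrightarrow> openin X (p w) \<and> openin X (q w)"
    and mono: "\<And>v w. \<lbrakk>v \<in> carrier P; w \<in> carrier P; v \<sqsubseteq>\<^bsub>P\<^esub> w\<rbrakk> \<Longrightarrow> p v \<subseteq> p w \<and> q v \<subseteq> q w"
    and lub: "\<And>D s. \<lbrakk>D \<subseteq> carrier P; least P s (Upper P D)\<rbrakk> \<Longrightarrow> p s \<subseteq> \<Union>(p ` D) \<and> q s \<subseteq> \<Union>(q ` D)"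
  shows "scott_open P {w \<in> carrier P. p w \<union> q w = topspace X}"
  unfolding scott_open_def
proof (intro conjI ballI allI impI)
  fix v w assume "v \<in> {w \<in> carrier P. p w \<union> q w = topspace X}" "w \<in> carrier P" "v \<sqsubseteq>\<^bsub>P\<^esub> w"
  then show "w \<in> {w \<in> carrier P. p w \<union> q w = topspace X}"
    using op mono openin_subset by blast
next
  fix D s
  assume *: "directed_in P D \<and> least P s (Upper P D) \<and> s \<in> {w \<in> carrier P. p w \<union> q w = topspace X}"
  then have D: "D \<subseteq> carrier P"
    by (simp add: directed_in_def)
  then have "topspace X \<subseteq> \<Union>((\<lambda>d. p d \<union> q d) ` D)"
    using lub[of D s] * by blast
  moreover have "\<forall>U\<in>(\<lambda>d. p d \<union> q d) ` D. openin X U"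
    using D op by blast
  ultimately obtain \<F> where "finite \<F>" "\<F> \<subseteq> (\<lambda>d. p d \<union> q d) ` D" "topspace X \<subseteq> \<Union>\<F>"
    using assms(1) unfolding compact_space_alt by meson
  then obtain D' where D': "finite D'" "D' \<subseteq> D" "topspace X \<subseteq> (\<Union>d\<in>D'. p d \<union> q d)"
    using finite_subset_image[of \<F> "\<lambda>d. p d \<union> q d" D] by blast
  have "\<exists>z\<in>D. (\<Union>d\<in>D'. p d \<union> q d) \<subseteq> p z \<union> q z"
    using D'(1,2)
  proof (induction D')
    case empty
    then show ?case
      using * by (auto simp: directed_in_def)
  next
    case (insert d D')
    then obtain z where "z \<in> D" "(\<Union>d\<in>D'. p d \<union> q d) \<subseteq> p z \<union> q z"
      by auto
    moreover obtain y where "y \<in> D" "z \<sqsubseteq>\<^bsub>P\<^esub> y" "d \<sqsubseteq>\<^bsub>P\<^esub> y"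
      using * insert.prems \<open>z \<in> D\<close> unfolding directed_in_def by blast
    moreover have "p z \<subseteq> p y \<and> q z \<subseteq> q y" "p d \<subseteq> p y \<and> q d \<subseteq> q y"
      by (rule mono; use calculation D insert.prems in blast)+
    ultimately show ?case
      by (intro bexI[of _ y]) auto
  qed
  then obtain z where z: "z \<in> D" "topspace X \<subseteq> p z \<union> q z"
    using D'(3) by auto
  moreover have "p z \<union> q z \<subseteq> topspace X"
    using op[of z] z(1) D openin_subset by blast
  ultimately show "D \<inter> {w \<in> carrier P. p w \<union> q w = topspace X} \<noteq> {}"
    using D by blast
qed auto

section \<open>Compact spaces with overlapping Scott open families\<close>

text \<open>\<open>overlap\<close> is the irreducibility of the family of proper open sets, stated
  through complements; \<open>cover\<close> rules out a greatest proper open set and supplies the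
  point of the product at which rectangles fail.\<close>

locale overlapping_space =
  fixes X :: "'a topology"
  assumes compact: "compact_space X"
    and overlap: "\<lbrakk>scott_open (opens X) \<U>; scott_open (opens X) \<V>;
        \<exists>U\<in>\<U>. U \<noteq> topspace X; \<exists>V\<in>\<V>. V \<noteq> topspace X\<rbrakk> \<Longrightarrow> \<exists>W\<in>\<U> \<inter> \<V>. W \<noteq> topspace X"
    and cover: "\<exists>U V. openin X U \<and> openin X V \<and> U \<noteq> topspace X \<and> V \<noteq> topspace X \<and> U \<union> V = topspace X"
begin

lemma not_sober_scott_opens: "\<not> sober (scott (opens X))"
proof
  assume sober: "sober (scott (opens X))"
  let ?C = "{U. openin X U \<and> U \<noteq> topspace X}"
  have "p s \<subseteq> \<Union>(p ` D)" if "D \<subseteq> carrier (opens X)" "least (opens X) s (Upper (opens X) D)" "p = id"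
    for D s and p :: "'a set \<Rightarrow> 'a set"
    using that least_opens[OF that(1)] by (auto simp: least_def)
  \<comment> \<open>With both maps equal to \<open>id\<close>, covering means
    \<open>U = topspace X\<close>: compactness makes the top element open by itself, so
    \<open>?C\<close> is closed.\<close>
  then have "scott_open (opens X) {U \<in> carrier (opens X). id U \<union> id U = topspace X}"
    by (intro scott_open_compact_cover compact) auto
  then have "openin (scott (opens X)) (carrier (opens X) - ?C)"
    unfolding openin_scott by (rule back_subst) auto
  then have closed: "closedin (scott (opens X)) ?C"
    by (auto simp: closedin_def topspace_scott)
  have "?C \<subseteq> A \<or> ?C \<subseteq> B"
    if "closedin (scott (opens X)) A" "closedin (scott (opens X)) B" "?C \<subseteq> A \<union> B" for A B
  proof (rule ccontr)
    assume "\<not> (?C \<subseteq> A \<or> ?C \<subseteq> B)"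
    moreover have "scott_open (opens X) (carrier (opens X) - A)" "scott_open (opens X) (carrier (opens X) - B)"
      using that by (auto simp: closedin_def topspace_scott openin_scott)
    ultimately obtain W where "W \<in> (carrier (opens X) - A) \<inter> (carrier (opens X) - B)" "W \<noteq> topspace X"
      using overlap[of "carrier (opens X) - A" "carrier (opens X) - B"] by auto
    then show False
      using that(3) by auto
  qed
  then have "irreducible_closedin (scott (opens X)) ?C"
    using closed cover by (auto simp: irreducible_closedin_def)
  moreover have "\<exists>W. openin X W \<and> C = scott (opens X) closure_of {W}"
    if "irreducible_closedin (scott (opens X)) C" for C
    using sober that unfolding sober_def topspace_scott by (metis carrier_opens mem_Collect_eq)
  ultimately obtain W where W: "openin X W" and C: "?C = scott (opens X) closure_of {W}"
    by blast
  \<comment> \<open>A generic point \<open>W\<close> would contain every proper open set and be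
    proper itself, against \<open>cover\<close>.\<close>
  have "U \<subseteq> W" if "U \<in> ?C" for U
  proof (rule ccontr)
    assume "\<not> U \<subseteq> W"
    have "\<forall>T. U \<in> T \<and> scott_open (opens X) T \<longrightarrow> W \<in> T"
      using that unfolding C in_closure_of openin_scott by simp
    from this[rule_format, of "{U. openin X U \<and> \<not> U \<subseteq> W}"] show False
      using \<open>\<not> U \<subseteq> W\<close> that scott_open_not_subset[OF W] by simp
  qed
  moreover have "W \<noteq> topspace X"
    using C closure_of_subset[of "{W}" "scott (opens X)"] W by (auto simp: topspace_scott)
  moreover have "W \<subseteq> topspace X"
    using W by (rule openin_subset)
  ultimately show False
    using cover by (metis (mono_tags, lifting) Un_subset_iff mem_Collect_eq subset_antisym)
qed

lemma scott_prod_order_not_subset: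
  "\<not> {W. openin (scott (prod_order (opens X) (opens X))) W}
    \<subseteq> {W. openin (prod_topology (scott (opens X)) (scott (opens X))) W}"
proof
  let ?P = "prod_order (opens X) (opens X)"
  let ?W = "{w \<in> carrier ?P. fst w \<union> snd w = topspace X}"
  assume sub: "{W. openin (scott ?P) W} \<subseteq> {W. openin (prod_topology (scott (opens X)) (scott (opens X))) W}"
  have "scott_open ?P ?W"
  proof (rule scott_open_compact_cover[OF compact])
    fix D s assume D: "D \<subseteq> carrier ?P" and s: "least ?P s (Upper ?P D)"
    have "(\<Union>(fst ` D), \<Union>(snd ` D)) \<in> Upper ?P D"
      using D by (subst Upper_prod_order) (fastforce simp: prod_order_def intro!: openin_Union)+
    from least_le[OF s this] show "fst s \<subseteq> \<Union>(fst ` D) \<and> snd s \<subseteq> \<Union>(snd ` D)"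
      by (simp add: prod_order_def)
  qed (auto simp: prod_order_def)
  then have op: "openin (prod_topology (scott (opens X)) (scott (opens X))) ?W"
    using sub openin_scott by blast
  obtain A B where AB: "openin X A" "openin X B" "A \<noteq> topspace X" "B \<noteq> topspace X" "A \<union> B = topspace X"
    using cover by blast
  then have "(A, B) \<in> ?W"
    by (simp add: prod_order_def)
  from op[unfolded openin_prod_topology_alt openin_scott, rule_format, OF this]
  obtain \<U> \<V> where \<U>\<V>: "scott_open (opens X) \<U>" "scott_open (opens X) \<V>"
    "A \<in> \<U>" "B \<in> \<V>" and W: "\<U> \<times> \<V> \<subseteq> ?W"
    by blast
  \<comment> \<open>A proper \<open>U\<close> in both factors gives the point \<open>(U, U)\<close>
    of the rectangle, which does not cover.\<close>
  then obtain U where "U \<in> \<U> \<inter> \<V>" "U \<noteq> topspace X"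
    using overlap[OF \<U>\<V>(1,2)] AB by blast
  then show False
    using W by auto
qed

lemma scott_product_order_neq:
  "scott (product_order (\<lambda>_. opens X) {0, 1 :: nat}) \<noteq> product_topology (\<lambda>_. scott (opens X)) {0, 1}"
proof
  let ?P = "product_order (\<lambda>_. opens X) {0, 1 :: nat}"
  let ?W = "{w \<in> carrier ?P. w 0 \<union> w 1 = topspace X}"
  assume eq: "scott ?P = product_topology (\<lambda>_. scott (opens X)) {0, 1}"
  have "scott_open ?P ?W"
  proof (rule scott_open_compact_cover[OF compact])
    fix D s assume D: "D \<subseteq> carrier ?P" and s: "least ?P s (Upper ?P D)"
    \<comment> \<open>The union is restricted because members of the carrier are
      \<open>undefined\<close> off the index set.\<close>
    let ?u = "\<lambda>i\<in>{0, 1 :: nat}. \<Union>w\<in>D. w i"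
    have "?u \<in> Upper ?P D"
      using D by (fastforce simp: Upper_def product_order_def)
    from least_le[OF s this] show "s 0 \<subseteq> \<Union>((\<lambda>w. w 0) ` D) \<and> s 1 \<subseteq> \<Union>((\<lambda>w. w 1) ` D)"
      by (simp add: product_order_def)
  qed (auto simp: product_order_def PiE_iff)
  then have op: "openin (product_topology (\<lambda>_. scott (opens X)) {0, 1 :: nat}) ?W"
    by (simp only: openin_scott flip: eq)
  obtain A B where AB: "openin X A" "openin X B" "A \<noteq> topspace X" "B \<noteq> topspace X" "A \<union> B = topspace X"
    using cover by blast
  then have "(\<lambda>i\<in>{0, 1 :: nat}. if i = 0 then A else B) \<in> ?W"
    by (auto simp: product_order_def)
  then obtain \<W> where \<W>: "\<forall>i\<in>{0, 1}. scott_open (opens X) (\<W> i)"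
    "(\<lambda>i\<in>{0, 1 :: nat}. if i = 0 then A else B) \<in> Pi\<^sub>E {0, 1} \<W>" "Pi\<^sub>E {0, 1} \<W> \<subseteq> ?W"
    using op unfolding openin_product_topology_alt openin_scott by meson
  then have "A \<in> \<W> 0" "B \<in> \<W> 1"
    by (auto simp: PiE_iff)
  then obtain U where U: "U \<in> \<W> 0 \<inter> \<W> 1" "U \<noteq> topspace X"
    using overlap[of "\<W> 0" "\<W> 1"] \<W>(1) AB by blast
  then have "(\<lambda>i\<in>{0, 1 :: nat}. U) \<in> Pi\<^sub>E {0, 1} \<W>"
    by auto
  with \<W>(3) have "(\<lambda>i\<in>{0, 1 :: nat}. U) \<in> ?W"
    by (rule subsetD)
  then show False
    using U by simp
qed

end

section \<open>The space of subtrees and fans\<close>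

text \<open>
  The successor keeps \<open>0\<close> from being a node. Nodes may coincide with the base points \<open>a\<close>, \<open>b\<close> of
  other blocks: no well-foundedness is needed, only injectivity.
\<close>
definition node :: "nat \<Rightarrow> nat \<Rightarrow> nat list \<Rightarrow> nat" where
  "node a b s = Suc (to_nat (a, b, s))"

definition subtree :: "nat \<Rightarrow> nat \<Rightarrow> nat list \<Rightarrow> nat set" where
  "subtree a b s = insert a {node a b t |t. prefix s t}"

text \<open>The entries of \<open>q\<close> serve both as path and as thresholds: lengthening
  \<open>q\<close> adds a level, and raising the new last entry shrinks that level towards the empty
  set.\<close>

definition fan :: "nat \<Rightarrow> nat \<Rightarrow> nat list \<Rightarrow> nat set" where
  "fan a b q = insert b {node a b (take i q @ [c]) |i c. i < length q \<and> q ! i \<le> c}"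

text \<open>Subtrees at the empty sequence are left out for the sake of compactness:
  \<open>subtree a b []\<close> meets each \<open>fan a b [k]\<close> in infinitely many nodes, but
  these fans have only \<open>b\<close> in common, which \<open>subtree a b []\<close> misses for
  instance when \<open>b = 0\<close> and \<open>a \<noteq> 0\<close>.\<close>

definition tree_fan_subbase :: "nat set set" where
  "tree_fan_subbase = {- subtree a b s |a b s. s \<noteq> []} \<union> {- fan a b q |a b q. True}"

definition tree_fan_space :: "nat topology" where
  "tree_fan_space =
    topology (arbitrary union_of (finite intersection_of (\<lambda>U. U \<in> tree_fan_subbase) relative_to UNIV))"

lemma node_eq_iff [simp]: "node a b s = node a' b' s' \<longleftrightarrow> a = a' \<and> b = b' \<and> s = s'"
  by (simp add: node_def)

lemma topspace_tree_fan_space [simp]: "topspace tree_fan_space = UNIV"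
  by (simp add: tree_fan_space_def)

lemma openin_tree_fan_subbase:
  assumes "U \<in> tree_fan_subbase"
  shows "openin tree_fan_space U"
proof -
  have "(finite intersection_of (\<lambda>U. U \<in> tree_fan_subbase) relative_to UNIV) (UNIV \<inter> U)"
    by (intro relative_to_inc finite_intersection_of_inc assms)
  then show ?thesis
    unfolding tree_fan_space_def openin_subbase by (simp add: arbitrary_union_of_inc)
qed

lemma openin_Compl_subtree: "s \<noteq> [] \<Longrightarrow> openin tree_fan_space (- subtree a b s)"
  by (rule openin_tree_fan_subbase) (auto simp: tree_fan_subbase_def)

lemma openin_Compl_fan: "openin tree_fan_space (- fan a b q)"
  by (rule openin_tree_fan_subbase) (unfold tree_fan_subbase_def, blast)

lemma fan_Nil [simp]: "fan a b [] = {b}"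
  by (simp add: fan_def)

lemma fan_snoc: "fan a b (q @ [k]) = fan a b q \<union> {node a b (q @ [c]) |c. k \<le> c}"
  unfolding fan_def by (auto simp: less_Suc_eq nth_append)

lemma openin_Compl_singleton: "openin tree_fan_space (- {b})"
  using openin_Compl_fan[of 0 b "[]"] by simp

lemma countable_tree_fan_subbase: "countable tree_fan_subbase"
proof -
  have "tree_fan_subbase \<subseteq> range (\<lambda>(a, b, s). - subtree a b s) \<union> range (\<lambda>(a, b, q). - fan a b q)"
    by (auto simp: tree_fan_subbase_def)
  then show ?thesis
    by (rule countable_subset) auto
qed

section \<open>Intersections of subbasic closed sets and compactness\<close>

text \<open>The last entry of \<open>s\<close> equals the threshold of \<open>q\<close> at its
  level, and thresholds are inclusive.\<close>

lemma node_in_fan: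
  assumes "prefix s q" "s \<noteq> []"
  shows "node a b s \<in> fan a b q"
proof -
  obtain r where q: "q = s @ r"
    using assms(1) by (auto simp: prefix_def)
  obtain t c where s: "s = t @ [c]"
    using assms(2) by (metis rev_exhaust)
  have "length t < length q" "q ! length t \<le> c" "take (length t) q @ [c] = s"
    by (simp_all add: q s)
  then show ?thesis
    unfolding fan_def by blast
qed

text \<open>A node of the fan is indexed by a prefix of \<open>q\<close> with one entry appended. If
  \<open>s\<close> is a prefix of such a sequence but not of \<open>q\<close>, it is the entire
  sequence, so besides \<open>a\<close> and \<open>b\<close> only \<open>node a b s\<close> can be
  common.\<close>

lemma finite_subtree_Int_fan:
  assumes "\<not> prefix s q"
  shows "finite (subtree a b s \<inter> fan a b q)"
proof (rule finite_subset)
  have "t = s" if "prefix s t" "t = take i q @ [c]" for t i c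
    using that assms take_is_prefix[of i q] prefix_order.trans by (metis prefix_snoc)
  then show "subtree a b s \<inter> fan a b q \<subseteq> {a, b, node a b s}"
    by (auto simp: subtree_def fan_def)
qed simp

lemma finite_Int_distinct_blocks:
  assumes "A \<subseteq> insert x (range (node a b))" "A' \<subseteq> insert x' (range (node a' b'))" "(a, b) \<noteq> (a', b')"
  shows "finite (A \<inter> A')"
proof (rule finite_subset)
  have "range (node a b) \<inter> range (node a' b') = {}"
    using assms(3) by auto
  then show "A \<inter> A' \<subseteq> {x, x'}"
    using assms(1,2) by blast
qed simp

lemma tree_fan_subbase_block:
  assumes "U \<in> tree_fan_subbase"
  obtains a b x where "- U \<subseteq> insert x (range (node a b))"
    "(\<exists>s. s \<noteq> [] \<and> U = - subtree a b s) \<or> (\<exists>q. U = - fan a b q)"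
proof -
  consider a b s where "s \<noteq> []" "U = - subtree a b s" | a b q where "U = - fan a b q"
    using assms by (auto simp: tree_fan_subbase_def)
  then show ?thesis
  proof cases
    case 1
    then show ?thesis
      by (intro that[of a a b]) (auto simp: subtree_def)
  next
    case 2
    then show ?thesis
      by (intro that[of b a b]) (auto simp: fan_def)
  qed
qed

lemma finite_subcover_if_cofinite:
  assumes "UNIV \<subseteq> \<Union>\<C>" "\<D> \<subseteq> \<C>" "finite \<D>" "finite (- \<Union>\<D>)"
  shows "\<exists>\<C>'. finite \<C>' \<and> \<C>' \<subseteq> \<C> \<and> UNIV \<subseteq> \<Union>\<C>'"
proof -
  have "- \<Union>\<D> \<subseteq> \<Union>\<C>"
    using subset_UNIV assms(1) by (rule subset_trans)
  with assms(4) obtain \<E> where "finite \<E>" "\<E> \<subseteq> \<C>" "- \<Union>\<D> \<subseteq> \<Union>\<E>"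
    by (rule finite_subset_Union)
  then show ?thesis
    using assms by (intro exI[of _ "\<D> \<union> \<E>"]) auto
qed

text \<open>
  Subbasic closed sets of different blocks meet in a finite set, and so do a subtree and a fan of
  one block unless the root of the subtree is a prefix of the fan's index. A family with no finite
  intersections therefore has a common point: \<open>a\<close>, \<open>b\<close>, or the root of the smallest subtree.
\<close>
lemma compact_tree_fan_space: "compact_space tree_fan_space"
proof (rule Alexander_subbase_alt)
  show "UNIV \<subseteq> \<Union>tree_fan_subbase"
  proof
    fix x :: nat
    have "x \<in> - fan 0 (Suc x) []"
      by simp
    moreover have "- fan 0 (Suc x) [] \<in> tree_fan_subbase"
      unfolding tree_fan_subbase_def by blast
    ultimately show "x \<in> \<Union>tree_fan_subbase"
      by blast
  qed
next
  fix \<C> :: "nat set set"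
  assume \<C>: "\<C> \<subseteq> tree_fan_subbase" "UNIV \<subseteq> \<Union>\<C>"
  show "\<exists>\<C>'. finite \<C>' \<and> \<C>' \<subseteq> \<C> \<and> UNIV \<subseteq> \<Union>\<C>'"
  proof (rule ccontr)
    assume no: "\<not> ?thesis"
    \<comment> \<open>Two members leaving only finitely many points uncovered would extend to a
      finite subcover; this forces all members into one block.\<close>
    have inf: "infinite (- U \<inter> - V)" if "U \<in> \<C>" "V \<in> \<C>" for U V
      using no finite_subcover_if_cofinite[OF \<C>(2), of "{U, V}"] that by auto
    obtain U\<^sub>0 where U\<^sub>0: "U\<^sub>0 \<in> \<C>"
      using \<C>(2) by blast
    then have "U\<^sub>0 \<in> tree_fan_subbase"
      using \<C>(1) by blast
    then obtain a b x\<^sub>0 where blk: "- U\<^sub>0 \<subseteq> insert x\<^sub>0 (range (node a b))"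
      by (rule tree_fan_subbase_block)
    have form: "(\<exists>s. s \<noteq> [] \<and> U = - subtree a b s) \<or> (\<exists>q. U = - fan a b q)" if "U \<in> \<C>" for U
    proof -
      have "U \<in> tree_fan_subbase"
        using \<C>(1) that by blast
      then obtain a' b' x' where *: "- U \<subseteq> insert x' (range (node a' b'))"
        "(\<exists>s. s \<noteq> [] \<and> U = - subtree a' b' s) \<or> (\<exists>q. U = - fan a' b' q)"
        by (rule tree_fan_subbase_block)
      then have "(a, b) = (a', b')"
        using finite_Int_distinct_blocks[OF blk *(1)] inf[OF U\<^sub>0 that] by blast
      then show ?thesis
        using *(2) by simp
    qed
    let ?S = "{s. s \<noteq> [] \<and> - subtree a b s \<in> \<C>}"
    \<comment> \<open>Every fan contains \<open>b\<close>, so a member covering \<open>b\<close> is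
      the complement of a subtree; likewise a member covering \<open>a\<close> is the complement of
      a fan.\<close>
    obtain U where U: "U \<in> \<C>" "b \<in> U"
      using \<C>(2) by blast
    then have "?S \<noteq> {}"
      using form[of U] by (auto simp: fan_def)
    obtain V where V: "V \<in> \<C>" "a \<in> V"
      using \<C>(2) by blast
    then obtain q where q: "- fan a b q \<in> \<C>"
      using form[of V] by (auto simp: subtree_def)
    have pre: "prefix s q" if "s \<in> ?S" "- fan a b q \<in> \<C>" for s q
      using that inf[of "- subtree a b s" "- fan a b q"] finite_subtree_Int_fan[of s q a b] by auto
    \<comment> \<open>All roots in \<open>?S\<close> are prefixes of the single index
      \<open>q\<close>, hence finitely many and linearly ordered, with a longest one
      \<open>m\<close>.\<close>
    have "?S \<subseteq> set (prefixes q)"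
      using pre q by auto
    then have "finite ?S"
      by (rule finite_subset) simp
    then have "Max (length ` ?S) \<in> length ` ?S" and max: "\<forall>s\<in>?S. length s \<le> Max (length ` ?S)"
      using \<open>?S \<noteq> {}\<close> by (intro Max_in Max_ge ballI; simp)+
    from this(1) obtain m where m: "Max (length ` ?S) = length m" "m \<in> ?S"
      by (rule imageE)
    have longest: "prefix s m" if "s \<in> ?S" for s
    proof (rule prefix_length_prefix)
      show "prefix s q" "prefix m q"
        using pre that m(2) q by blast+
      show "length s \<le> length m"
        using max that m(1) by metis
    qed
    \<comment> \<open>This node lies in each subtree because the root is a prefix of
      \<open>m\<close>, and in each fan because \<open>m\<close> is a nonempty prefix of the
      index.\<close>
    have "node a b m \<notin> W" if W: "W \<in> \<C>" for W
    proof -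
      from form[OF W] consider s where "s \<noteq> []" "W = - subtree a b s" | r where "W = - fan a b r"
        by (elim disjE exE conjE)
      then show ?thesis
      proof cases
        case 1
        then show ?thesis
          using W longest[of s] by (auto simp: subtree_def)
      next
        case 2
        then show ?thesis
          using W m pre[of m r] node_in_fan[of m r a b] by auto
      qed
    qed
    then show False
      using \<C>(2) by blast
  qed
qed (simp add: tree_fan_space_def)

section \<open>Scott open families on the tree-fan space\<close>

lemma scott_open_fan_step:
  assumes "scott_open (opens tree_fan_space) \<V>" "- fan a b q \<in> \<V>"
  shows "\<exists>k. - fan a b (q @ [k]) \<in> \<V>"
proof (rule scott_open_UN_incseq[OF assms(1)])
  show "incseq (\<lambda>k. - fan a b (q @ [k]))"
    unfolding fan_snoc by (rule incseq_SucI) auto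
  have "\<exists>k. x \<notin> fan a b (q @ [k])" if "x \<notin> fan a b q" for x
  proof (cases "\<exists>c. x = node a b (q @ [c])")
    case True
    then obtain c where "x = node a b (q @ [c])"
      by blast
    \<comment> \<open>The threshold \<open>Suc c\<close> is the first to exclude the child labelled
      \<open>c\<close>.\<close>
    then show ?thesis
      using that by (intro exI[of _ "Suc c"]) (simp add: fan_snoc)
  qed (use that in \<open>auto simp: fan_snoc\<close>)
  then have "(\<Union>k. - fan a b (q @ [k])) = - fan a b q"
    by (auto simp: fan_snoc)
  then show "(\<Union>k. - fan a b (q @ [k])) \<in> \<V>"
    using assms(2) by simp
qed (rule openin_Compl_fan)

text \<open>Length \<open>Suc n\<close> keeps the roots nonempty, as openness requires, and no
  sequence \<open>t\<close> extends \<open>l (length t)\<close>, so the subtrees intersect in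
  \<open>{a}\<close>.\<close>

lemma scott_open_subtree_branch:
  assumes "scott_open (opens tree_fan_space) \<U>" "- {a} \<in> \<U>"
    and l: "\<And>n. length (l n) = Suc n" "\<And>n. prefix (l n) (l (Suc n))"
  shows "\<exists>n. - subtree a b (l n) \<in> \<U>"
proof (rule scott_open_UN_incseq[OF assms(1)])
  show "openin tree_fan_space (- subtree a b (l n))" for n
    using l(1)[of n] by (intro openin_Compl_subtree) auto
  have "subtree a b (l (Suc n)) \<subseteq> subtree a b (l n)" for n
    using l(2)[of n] prefix_order.trans by (fastforce simp: subtree_def)
  then show "incseq (\<lambda>n. - subtree a b (l n))"
    by (intro incseq_SucI) auto
  have "x = a" if x: "\<forall>n. x \<in> subtree a b (l n)" for x
  proof (rule ccontr)
    assume "x \<noteq> a"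
    moreover have "x \<in> subtree a b (l 0)"
      using x by simp
    ultimately obtain t where t: "x = node a b t"
      unfolding subtree_def by blast
    have "x \<in> subtree a b (l (length t))"
      using x by simp
    then have "prefix (l (length t)) t"
      using \<open>x \<noteq> a\<close> t by (simp add: subtree_def)
    then show False
      using prefix_length_le l(1) by fastforce
  qed
  moreover have "a \<in> subtree a b s" for s
    by (simp add: subtree_def)
  ultimately have "(\<Union>n. - subtree a b (l n)) = - {a}"
    by blast
  then show "(\<Union>n. - subtree a b (l n)) \<in> \<U>"
    using assms(2) by simp
qed

text \<open>Points are closed and Scott open families are upward closed, so proper members can be
  replaced by complements of points.\<close>

lemma scott_open_Compl_singleton:
  assumes "scott_open (opens tree_fan_space) \<U>" "U \<in> \<U>" "x \<notin> U"
  shows "- {x} \<in> \<U>"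
  using assms openin_Compl_singleton[of x] unfolding scott_open_def by auto

lemma scott_open_overlap:
  assumes \<U>: "scott_open (opens tree_fan_space) \<U>" "- {a} \<in> \<U>"
    and \<V>: "scott_open (opens tree_fan_space) \<V>" "- {b} \<in> \<V>"
  shows "\<exists>x. - {x} \<in> \<U> \<inter> \<V>"
proof -
  obtain g where g: "\<And>q. - fan a b q \<in> \<V> \<Longrightarrow> - fan a b (q @ [g q]) \<in> \<V>"
    using scott_open_fan_step[OF \<V>(1)] by metis
  \<comment> \<open>The branch iterates the choice of thresholds, so the complements of all fans
    along it stay in \<open>\<V>\<close>.\<close>
  define l where "l n = ((\<lambda>q. q @ [g q]) ^^ n) []" for n
  have l_Suc: "l (Suc n) = l n @ [g (l n)]" for n
    by (simp add: l_def)
  have fan: "- fan a b (l n) \<in> \<V>" for n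
    by (induction n) (use \<V>(2) in \<open>simp_all add: l_Suc g, simp add: l_def\<close>)
  have len: "length (l n) = n" for n
    by (induction n) (simp_all add: l_Suc, simp add: l_def)
  \<comment> \<open>The shift to \<open>Suc n\<close> drops the empty start of the branch, where
    there is no subbasic subtree.\<close>
  obtain n where n: "- subtree a b (l (Suc n)) \<in> \<U>"
    using scott_open_subtree_branch[OF \<U>, of "\<lambda>n. l (Suc n)"] len by (auto simp: l_Suc)
  have "node a b (l (Suc n)) \<in> subtree a b (l (Suc n))"
    by (simp add: subtree_def)
  moreover have "node a b (l (Suc n)) \<in> fan a b (l (Suc n))"
    by (intro node_in_fan) (simp_all add: l_Suc)
  ultimately show ?thesis
    using scott_open_Compl_singleton[OF \<U>(1) n] scott_open_Compl_singleton[OF \<V>(1) fan] by blast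
qed

interpretation tree_fan: overlapping_space tree_fan_space
proof
  show "\<exists>W\<in>\<U> \<inter> \<V>. W \<noteq> topspace tree_fan_space"
    if \<U>\<V>: "scott_open (opens tree_fan_space) \<U>" "scott_open (opens tree_fan_space) \<V>"
      "\<exists>U\<in>\<U>. U \<noteq> topspace tree_fan_space" "\<exists>V\<in>\<V>. V \<noteq> topspace tree_fan_space" for \<U> \<V>
  proof -
    obtain U a V b where "U \<in> \<U>" "a \<notin> U" "V \<in> \<V>" "b \<notin> V"
      using \<U>\<V>(3,4) by auto
    then show ?thesis
      using scott_open_overlap[OF \<U>\<V>(1) _ \<U>\<V>(2)] scott_open_Compl_singleton \<U>\<V>(1,2)
      by (metis Compl_iff UNIV_I insertI1 topspace_tree_fan_space)
  qed
  have "- {0} \<union> - {1} = (UNIV :: nat set)"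
    by auto
  then show "\<exists>U V. openin tree_fan_space U \<and> openin tree_fan_space V \<and> U \<noteq> topspace tree_fan_space \<and>
      V \<noteq> topspace tree_fan_space \<and> U \<union> V = topspace tree_fan_space"
    using openin_Compl_singleton[of 0] openin_Compl_singleton[of 1]
    by (intro exI[of _ "- {0}"] exI[of _ "- {1}"]) auto
qed (rule compact_tree_fan_space)

text \<open>The nodes over sequences of length one form an infinite discrete subspace.\<close>
lemma openin_isolating_node:
  "\<exists>U. openin tree_fan_space U \<and> (\<forall>d. node 0 0 [d] \<in> U \<longleftrightarrow> d = c)"
proof -
  \<comment> \<open>Removing the fan cuts off all labels above \<open>c\<close>, and removing
    finitely many points deals with those below; the base point \<open>0\<close> is not a
    node.\<close>
  define U where "U = - fan 0 0 [Suc c] \<inter> (\<Inter>d<c. - {node 0 0 [d]})"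
  have "openin tree_fan_space U"
  proof (cases "c = 0")
    case False
    then show ?thesis
      unfolding U_def
      by (intro openin_Int openin_Compl_fan openin_INT2 openin_Compl_singleton) auto
  qed (simp add: U_def openin_Compl_fan)
  moreover have "node 0 0 [d] \<in> U \<longleftrightarrow> d = c" for d
    by (auto simp: U_def fan_def node_def)
  ultimately show ?thesis
    by blast
qed

text \<open>For the lower bound, a set of labels is recovered from the union of its isolating
  neighbourhoods by testing the nodes over sequences of length one.\<close>

lemma opens_tree_fan_space_eqpoll: "carrier (opens tree_fan_space) \<approx> Pow (UNIV :: nat set)"
proof (rule lepoll_antisym)
  show "carrier (opens tree_fan_space) \<lesssim> Pow (UNIV :: nat set)"
    by (rule subset_imp_lepoll) auto
  obtain U where U: "\<And>c. openin tree_fan_space (U c)" "\<And>c d. node 0 0 [d] \<in> U c \<longleftrightarrow> d = c"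
    using openin_isolating_node by metis
  have "C = {d. node 0 0 [d] \<in> (\<Union>c\<in>C. U c)}" for C
    using U(2) by auto
  then have "inj (\<lambda>C. \<Union>c\<in>C. U c)"
    by (rule inj_on_inverseI[where g = "\<lambda>V. {d. node 0 0 [d] \<in> V}", OF sym])
  moreover have "openin tree_fan_space (\<Union>c\<in>C. U c)" for C
    using U(1) by blast
  ultimately show "Pow (UNIV :: nat set) \<lesssim> carrier (opens tree_fan_space)"
    unfolding lepoll_def by (intro exI[of _ "\<lambda>C. \<Union>c\<in>C. U c"]) auto
qed

theorem corollary5p6:
  shows "(\<exists>L0 :: nat set gorder.
            frame L0 \<and> countably_generated L0 \<and> spatial L0 \<and>
            carrier L0 \<approx> Pow (UNIV :: nat set) \<and>
            \<not> sober (scott L0) \<and>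
            {U. openin (prod_topology (scott L0) (scott L0)) U}
              \<subset> {U. openin (scott (prod_order L0 L0)) U})
       \<and> \<not> (\<forall>(I :: nat set) (L :: nat \<Rightarrow> nat set gorder).
              (\<forall>i\<in>I. frame (L i) \<and> countably_generated (L i)) \<longrightarrow>
              scott (product_order L I) = product_topology (\<lambda>i. scott (L i)) I)
       \<and> \<not> (\<forall>L :: nat set gorder.
              frame L \<and> countably_generated L \<and> spatial L \<longrightarrow>
              scott (product_order (\<lambda>_. L) {0, 1 :: nat})
                = product_topology (\<lambda>_. scott L) {0, 1 :: nat})"
proof (intro conjI)
  let ?L = "opens tree_fan_space"
  have gen: "countably_generated ?L"
    using countable_tree_fan_subbase tree_fan_space_def[symmetric] by (rule countably_generated_opens)
  note L = frame_opens[of tree_fan_space] gen spatial_opens[of tree_fan_space]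
  show "\<exists>L0 :: nat set gorder. frame L0 \<and> countably_generated L0 \<and> spatial L0 \<and>
      carrier L0 \<approx> Pow (UNIV :: nat set) \<and> \<not> sober (scott L0) \<and>
      {U. openin (prod_topology (scott L0) (scott L0)) U} \<subset> {U. openin (scott (prod_order L0 L0)) U}"
    using L opens_tree_fan_space_eqpoll tree_fan.not_sober_scott_opens
      tree_fan.scott_prod_order_not_subset openin_prod_topology_imp_scott
    by (intro exI[of _ ?L]) blast
  show "\<not> (\<forall>(I :: nat set) (L :: nat \<Rightarrow> nat set gorder).
      (\<forall>i\<in>I. frame (L i) \<and> countably_generated (L i)) \<longrightarrow>
      scott (product_order L I) = product_topology (\<lambda>i. scott (L i)) I)"
  proof
    assume "\<forall>(I :: nat set) (L :: nat \<Rightarrow> nat set gorder).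
      (\<forall>i\<in>I. frame (L i) \<and> countably_generated (L i)) \<longrightarrow>
      scott (product_order L I) = product_topology (\<lambda>i. scott (L i)) I"
    from this[rule_format, of "{0, 1}" "\<lambda>_. ?L", OF conjI[OF L(1,2)]] show False
      using tree_fan.scott_product_order_neq by contradiction
  qed
  show "\<not> (\<forall>L :: nat set gorder. frame L \<and> countably_generated L \<and> spatial L \<longrightarrow>
      scott (product_order (\<lambda>_. L) {0, 1 :: nat}) = product_topology (\<lambda>_. scott L) {0, 1 :: nat})"
  proof
    assume "\<forall>L :: nat set gorder. frame L \<and> countably_generated L \<and> spatial L \<longrightarrow>
      scott (product_order (\<lambda>_. L) {0, 1 :: nat}) = product_topology (\<lambda>_. scott L) {0, 1 :: nat}"
    from this[rule_format, of ?L, OF conjI[OF L(1) conjI[OF L(2,3)]]] show False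
      using tree_fan.scott_product_order_neq by contradiction
  qed
qed

end
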